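(* Let $C$ be any bivariate copula with $\mu_\infty(C)=m$. Then \[ 1-12m^2\geqslant\phi(C)\geqslant\begin{cases}-\frac12, & \text{if } 0\leqslant m\leqslant\frac14,\\ 24m^2-12m+1, & \text{if }\frac14\leqslant m\leqslant\frac13,\end{cases} \] and the bounds are attained (for each $m\in[0,\frac13]$, each of the two bounds is attained by some copula $C$ with $\mu_\infty(C)=m$). In particular, if $C$ is symmetric (i.e. $C(u,v)=C(v,u)$ for all $u,v$), then $\phi(C)$ can take any value in $[-\frac12,1]$; and if $C$ takes the maximal possible asymmetry $\mu_\infty(C)=\frac13$, then $\phi(C)=-\frac13$.
   Context: For a bivariate copula $C$, the measure of asymmetry is $\mu_\infty(C)=\max_{u,v\in[0,1]}|C(u,v)-C(v,u)|$; its range over all copulas is $[0,\frac13]$. For copulas $C_1,C_2$ the concordance function is $\mathcal{Q}(C_1,C_2)=4\int_{[0,1]^2}C_2(u,v)\,dC_1(u,v)-1$. Spearman's footrule is $\phi(C)=\frac12\left(3\,\mathcal{Q}(C,M)-1\right)$, where $M(u,v)=\min\{u,v\}$. *)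

theory Defs
  imports "HOL-Analysis.Analysis"
begin

text \<open>
  A bivariate copula is a function on the unit square; it is represented by a curried function on
  the reals of which only the values on the unit square matter.
\<close>

definition copula :: "(real \<Rightarrow> real \<Rightarrow> real) \<Rightarrow> bool" where
  "copula C \<longleftrightarrow>
     (\<forall>u\<in>{0..1}. C u 0 = 0 \<and> C 0 u = 0 \<and> C u 1 = u \<and> C 1 u = u) \<and>
     (\<forall>u1 u2 v1 v2. 0 \<le> u1 \<and> u1 \<le> u2 \<and> u2 \<le> 1 \<and> 0 \<le> v1 \<and> v1 \<le> v2 \<and> v2 \<le> 1 \<longrightarrow>
        0 \<le> C u2 v2 - C u2 v1 - C u1 v2 + C u1 v1)"

definition symmetric_copula :: "(real \<Rightarrow> real \<Rightarrow> real) \<Rightarrow> bool" where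
  "symmetric_copula C \<longleftrightarrow> copula C \<and> (\<forall>u\<in>{0..1}. \<forall>v\<in>{0..1}. C u v = C v u)"

text \<open>
  The supremum is a maximum for every copula, see \<open>asymmetry_is_max\<close> below.
\<close>

definition asymmetry :: "(real \<Rightarrow> real \<Rightarrow> real) \<Rightarrow> real" where
  "asymmetry C = (SUP (u, v) \<in> {0..1} \<times> {0..1}. \<bar>C u v - C v u\<bar>)"

definition copula_M :: "real \<Rightarrow> real \<Rightarrow> real" where
  "copula_M u v = min u v"

text \<open>
  The probability measure on the unit square with distribution function \<open>C\<close>: the boxes
  \<open>{0..u} \<times> {0..v}\<close> are closed under intersection and generate the Borel sets of the square, and
  for a copula \<open>C\<close> there is exactly one measure giving each of them the mass \<open>C u v\<close>.  (If there
  is no such measure, which does not happen for copulas, \<^const>\<open>extend_measure\<close> returns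
  the null measure.)
\<close>

definition copula_measure :: "(real \<Rightarrow> real \<Rightarrow> real) \<Rightarrow> (real \<times> real) measure" where
  "copula_measure C =
     extend_measure ({0..1} \<times> {0..1}) ({0..1} \<times> {0..1})
       (\<lambda>(u, v). {0..u} \<times> {0..v}) (\<lambda>(u, v). ennreal (C u v))"

definition concordance :: "(real \<Rightarrow> real \<Rightarrow> real) \<Rightarrow> (real \<Rightarrow> real \<Rightarrow> real) \<Rightarrow> real" where
  "concordance C1 C2 = 4 * (LINT (u, v)|copula_measure C1. C2 u v) - 1"

definition footrule :: "(real \<Rightarrow> real \<Rightarrow> real) \<Rightarrow> real" where
  "footrule C = (3 * concordance C copula_M - 1) / 2"

lemma copula_increment_fst:
  assumes "copula C" "0 \<le> u1" "u1 \<le> u2" "u2 \<le> 1" "0 \<le> v" "v \<le> 1"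
  shows "C u1 v \<le> C u2 v" "C u2 v - C u1 v \<le> u2 - u1"
proof -
  have m: "C u 0 = 0" "C u 1 = u" if "0 \<le> u" "u \<le> 1" for u
    using assms(1) that by (auto simp: copula_def)
  have i: "0 \<le> C u2 b - C u2 a - C u1 b + C u1 a" if "0 \<le> a" "a \<le> b" "b \<le> 1" for a b
    using assms that unfolding copula_def by blast
  show "C u1 v \<le> C u2 v" using i[of 0 v] m[of u1] m[of u2] assms by simp
  show "C u2 v - C u1 v \<le> u2 - u1" using i[of v 1] m[of u1] m[of u2] assms by simp
qed

lemma copula_transpose: "copula C \<Longrightarrow> copula (\<lambda>u v. C v u)"
  unfolding copula_def by (auto simp: algebra_simps)

lemma copula_lipschitz:
  assumes "copula C" "u \<in> {0..1}" "u' \<in> {0..1}" "v \<in> {0..1}" "v' \<in> {0..1}"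
  shows "\<bar>C u v - C u' v'\<bar> \<le> \<bar>u - u'\<bar> + \<bar>v - v'\<bar>"
proof -
  have a: "\<bar>D x w - D y w\<bar> \<le> \<bar>x - y\<bar>"
    if "copula D" "x \<in> {0..1}" "y \<in> {0..1}" "w \<in> {0..1}" for D x y w
    using copula_increment_fst[OF that(1), of x y w] copula_increment_fst[OF that(1), of y x w] that
    by (cases "x \<le> y") auto
  show ?thesis
    using a[OF assms(1), of u u' v] a[OF copula_transpose[OF assms(1)], of v v' u'] assms
    by auto
qed

lemma copula_continuous_on:
  assumes "copula C"
  shows "continuous_on ({0..1} \<times> {0..1}) (\<lambda>p. C (fst p) (snd p))"
proof (rule continuous_on_iff[THEN iffD2], intro ballI allI impI)
  fix p :: "real \<times> real" and e :: real
  assume p: "p \<in> {0..1} \<times> {0..1}" and e: "0 < e"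
  have "dist (C (fst q) (snd q)) (C (fst p) (snd p)) < e"
    if q: "q \<in> {0..1} \<times> {0..1}" "dist q p < e / 2" for q
    using copula_lipschitz[OF assms, of "fst q" "fst p" "snd q" "snd p"]
      dist_fst_le[of q p] dist_snd_le[of q p] p q
    by (auto simp: dist_real_def)
  then show "\<exists>d>0. \<forall>q\<in>{0..1} \<times> {0..1}. dist q p < d \<longrightarrow>
      dist (C (fst q) (snd q)) (C (fst p) (snd p)) < e"
    using e by (intro exI[of _ "e / 2"]) auto
qed

lemma asymmetry_is_max:
  assumes "copula C"
  shows "\<exists>u\<in>{0..1}. \<exists>v\<in>{0..1}. asymmetry C = \<bar>C u v - C v u\<bar> \<and>
           (\<forall>x\<in>{0..1}. \<forall>y\<in>{0..1}. \<bar>C x y - C y x\<bar> \<le> \<bar>C u v - C v u\<bar>)"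
proof -
  let ?S = "{0..1} \<times> {0..1} :: (real \<times> real) set"
  let ?f = "\<lambda>p. \<bar>C (fst p) (snd p) - C (snd p) (fst p)\<bar>"
  have "continuous_on ?S ?f"
    using copula_continuous_on[OF assms] copula_continuous_on[OF copula_transpose[OF assms]]
    by (intro continuous_intros) auto
  moreover have "compact ?S" by (intro compact_Times compact_Icc)
  moreover have "?S \<noteq> {}" by simp
  ultimately obtain p where p: "p \<in> ?S" "\<And>q. q \<in> ?S \<Longrightarrow> ?f q \<le> ?f p"
    using continuous_attains_sup[of ?S ?f] by blast
  have "asymmetry C = Sup (?f ` ?S)"
    by (simp add: asymmetry_def case_prod_unfold)
  also have "\<dots> = ?f p"
    using p by (intro cSup_eq_maximum) auto
  finally show ?thesis using p
    by (intro bexI[of _ "fst p"] bexI[of _ "snd p"]) auto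
qed

end

theory Submission
  imports Defs
begin

text \<open>
  Writing \<open>min u v\<close> as the length of \<open>{t \<ge> 0. t < u \<and> t < v}\<close> and applying Fubini turns the footrule into
  \<open>6 \<integral> C t t dt - 2\<close>, so only the diagonal of \<open>C\<close> matters. If \<open>C a b - C b a = m\<close> with \<open>a \<le> b\<close>
  (transpose \<open>C\<close> if necessary), then monotonicity and the Lipschitz property, started from
  \<open>C b a \<le> a - m\<close> and \<open>C a b \<ge> m\<close>, bound the diagonal by explicit piecewise affine functions from above
  and below. In the extremal cases, where \<open>b - a = m\<close> for the upper bound, these are the diagonals of
  a shuffle of \<open>M\<close> and of a flipped shuffle of \<open>M\<close> with asymmetry \<open>m\<close>.

  That a copula has a measure at all is shown by disintegration: the measures on the line with
  distribution functions \<open>C \<cdot> q\<close>, \<open>q\<close> rational, have densities \<open>h q\<close> with respect to the one for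
  \<open>q = 1\<close>, which can be chosen increasing in \<open>q\<close>; the measure is the law of \<open>(x, V (x, w))\<close> where
  \<open>V (x, w) = Inf {q. w \<le> h q x}\<close>.
\<close>

subsection \<open>Existence of the measure of a copula\<close>

text \<open>The sum of the measures belonging to \<open>F\<close> and to \<open>G - F\<close> agrees
  with the measure belonging to \<open>G\<close> on half-open intervals, hence on all Borel sets,
  and the summand for \<open>G - F\<close> is nonnegative.\<close>

lemma emeasure_interval_measure_mono:
  fixes F G :: "real \<Rightarrow> real"
  assumes F: "mono F" "continuous_on UNIV F" and G: "mono G" "continuous_on UNIV G"
    and D: "mono (\<lambda>x. G x - F x)" and A: "A \<in> sets borel"
  shows "emeasure (interval_measure F) A \<le> emeasure (interval_measure G) A"
proof -
  let ?D = "\<lambda>x. G x - F x"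
  let ?\<mu> = "\<lambda>A. emeasure (interval_measure F) A + emeasure (interval_measure ?D) A"
  define S where "S = measure_of UNIV (sets borel) ?\<mu>"
  have ca: "countably_additive (sets borel) ?\<mu>"
    unfolding countably_additive_def by (auto simp: suminf_add[symmetric] suminf_emeasure)
  have S: "emeasure S B = ?\<mu> B" if "B \<in> sets borel" for B
    unfolding S_def using ca that sets.sigma_algebra_axioms[of borel]
    by (intro emeasure_measure_of_sigma) (auto simp: positive_def)
  have Ioc: "emeasure (interval_measure H) {a<..b} = ennreal (H b - H a)"
    if "mono H" "continuous_on UNIV H" "a \<le> b" for H :: "real \<Rightarrow> real" and a b
    using that by (intro emeasure_interval_measure_Ioc)
      (auto simp: mono_def continuous_on_eq_continuous_within intro: continuous_at_imp_continuous_within)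
  have D': "continuous_on UNIV ?D" by (intro continuous_intros F G)
  have Ioc_sets: "sets borel = sigma_sets UNIV (range (\<lambda>(a,b). {a<..b::real}))"
    by (subst borel_sigma_sets_Ioc) simp
  have "S = interval_measure G"
  proof (rule measure_eqI_generator_eq[where E="range (\<lambda>(a,b). {a<..b::real})" and \<Omega>=UNIV
        and A="\<lambda>n. {- real n<..real n}"])
    show "Int_stable (range (\<lambda>(a,b). {a<..b::real}))"
      by (auto simp: Int_stable_def)
    show "emeasure S X = emeasure (interval_measure G) X" if X: "X \<in> range (\<lambda>(a,b). {a<..b::real})" for X
    proof -
      obtain a b where ab: "X = {a<..b}" using X by auto
      show ?thesis
      proof (cases "a \<le> b")
        case True
        then show ?thesis
          using monoD[OF F(1) True] monoD[OF D True] unfolding ab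
          by (simp add: S Ioc F G D D' flip: ennreal_plus)
      next
        case False
        then show ?thesis by (simp add: ab)
      qed
    qed
    show "sets S = sigma_sets UNIV (range (\<lambda>(a,b). {a<..b::real}))"
      unfolding S_def Ioc_sets[symmetric] using sets.sigma_sets_eq[of "borel :: real measure"] by simp
    show "sets (interval_measure G) = sigma_sets UNIV (range (\<lambda>(a,b). {a<..b::real}))"
      by (simp add: Ioc_sets)
    show "(\<Union>n. {- real n<..real n}) = UNIV"
    proof -
      have "\<exists>n. - real n < x \<and> x \<le> real n" for x
        using reals_Archimedean2[of "\<bar>x\<bar>"] by (metis abs_less_iff less_imp_le minus_less_iff)
      then show ?thesis by auto
    qed
    show "emeasure S {- real n<..real n} \<noteq> \<infinity>" for n
      by (simp add: S Ioc F G D D' flip: ennreal_plus)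
  qed auto
  then show ?thesis using S[OF A] by simp
qed

text \<open>If the set where \<open>g < f\<close> were not null, the integral of \<open>g\<close>
  over it would be finite and strictly below that of \<open>f\<close>, against the assumed
  domination.\<close>

lemma AE_le_of_density_le:
  fixes f g :: "'a \<Rightarrow> ennreal"
  assumes [measurable]: "f \<in> borel_measurable M" "g \<in> borel_measurable M"
    and fin: "finite_measure (density M f)"
    and le: "\<And>A. A \<in> sets M \<Longrightarrow> emeasure (density M f) A \<le> emeasure (density M g) A"
  shows "AE x in M. f x \<le> g x"
proof -
  define A where "A = {x\<in>space M. g x < f x}"
  have [measurable]: "A \<in> sets M" unfolding A_def by measurable
  let ?f = "\<lambda>x. f x * indicator A x" and ?g = "\<lambda>x. g x * indicator A x"
  have fA: "(\<integral>\<^sup>+x. ?f x \<partial>M) = emeasure (density M f) A" and gA: "(\<integral>\<^sup>+x. ?g x \<partial>M) = emeasure (density M g) A"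
    by (simp_all add: emeasure_density)
  have gf: "?g x \<le> ?f x" for x by (auto simp: indicator_def A_def)
  have "emeasure (density M f) A < \<infinity>"
    using finite_measure.emeasure_finite[OF fin, of A] by (simp add: less_top)
  then have "(\<integral>\<^sup>+x. ?g x \<partial>M) \<noteq> \<infinity>"
    using nn_integral_mono[of M ?g ?f] gf fA by (auto simp: top_unique)
  from nn_integral_less[OF _ _ this, of ?f] have "AE x in M. ?f x \<le> ?g x"
    using le[of A] fA gA gf by force
  with AE_space show ?thesis
    by eventually_elim (auto simp: A_def indicator_def not_less split: if_splits intro: leI)
qed

text \<open>Radon-Nikodym densities \<open>f q\<close> are increasing in \<open>q\<close> only
  almost everywhere, with a null set for each pair. Since \<open>Q\<close> is countable, the
  supremum of all \<open>f p\<close> with \<open>p \<le> q\<close> differs from \<open>f q\<close>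
  on a null set only, and it increases in \<open>q\<close> at every point.\<close>

lemma monotone_densities:
  fixes \<mu> :: "real \<Rightarrow> 'a measure"
  assumes Q: "countable Q" "1 \<in> Q" "\<And>q. q \<in> Q \<Longrightarrow> q \<le> 1"
    and fin: "\<And>q. q \<in> Q \<Longrightarrow> finite_measure (\<mu> q)" and sets: "\<And>q. q \<in> Q \<Longrightarrow> sets (\<mu> q) = sets (\<mu> 1)"
    and le: "\<And>p q A. p \<in> Q \<Longrightarrow> q \<in> Q \<Longrightarrow> p \<le> q \<Longrightarrow> A \<in> sets (\<mu> 1) \<Longrightarrow> emeasure (\<mu> p) A \<le> emeasure (\<mu> q) A"
  obtains h :: "real \<Rightarrow> 'a \<Rightarrow> ennreal" where "\<And>q. q \<in> Q \<Longrightarrow> h q \<in> borel_measurable (\<mu> 1)"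
    "\<And>q. q \<in> Q \<Longrightarrow> density (\<mu> 1) (h q) = \<mu> q"
    "\<And>p q x. p \<in> Q \<Longrightarrow> q \<in> Q \<Longrightarrow> p \<le> q \<Longrightarrow> h p x \<le> h q x"
proof -
  interpret finite_measure "\<mu> 1" using fin Q by auto
  have "\<exists>f\<in>borel_measurable (\<mu> 1). density (\<mu> 1) f = \<mu> q" if q: "q \<in> Q" for q
  proof (rule Radon_Nikodym)
    show "absolutely_continuous (\<mu> 1) (\<mu> q)"
      unfolding absolutely_continuous_def
    proof
      fix A assume "A \<in> null_sets (\<mu> 1)"
      then show "A \<in> null_sets (\<mu> q)"
        using le[OF q Q(2) Q(3)[OF q], of A] sets[OF q] by (auto simp: null_sets_def)
    qed
  qed (rule sets[OF q])
  then obtain f where f: "\<And>q. q \<in> Q \<Longrightarrow> f q \<in> borel_measurable (\<mu> 1)"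
      "\<And>q. q \<in> Q \<Longrightarrow> density (\<mu> 1) (f q) = \<mu> q" by metis
  have ae: "AE x in \<mu> 1. f p x \<le> f q x" if "p \<in> Q" "q \<in> Q" "p \<le> q" for p q
    using that f fin le by (intro AE_le_of_density_le) auto
  define h where "h q x = (SUP p\<in>{p\<in>Q. p \<le> q}. f p x)" for q x
  have cq: "countable {p\<in>Q. p \<le> q}" for q using Q(1) by (rule countable_subset[rotated]) auto
  show ?thesis
  proof
    show m: "h q \<in> borel_measurable (\<mu> 1)" if "q \<in> Q" for q
      unfolding h_def using cq f by (intro borel_measurable_SUP) auto
    show "density (\<mu> 1) (h q) = \<mu> q" if q: "q \<in> Q" for q
    proof -
      have "AE x in \<mu> 1. \<forall>p\<in>{p\<in>Q. p \<le> q}. f p x \<le> f q x"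
        using ae q by (intro AE_ball_countable[OF cq, THEN iffD2]) auto
      then have "AE x in \<mu> 1. h q x = f q x"
        by eventually_elim (auto simp: h_def q intro!: antisym SUP_least SUP_upper)
      then show ?thesis using f[OF q] m[OF q] density_cong by metis
    qed
    show "h p x \<le> h q x" if "p \<in> Q" "q \<in> Q" "p \<le> q" for p q x
      unfolding h_def using that by (intro SUP_subset_mono) auto
  qed
qed

lemma copula_margins:
  assumes "copula C" "v \<in> {0..1}"
  shows "C 0 v = 0" "C v 0 = 0" "C 1 v = v" "C v 1 = v"
  using assms by (auto simp: copula_def)

text \<open>The value of \<open>extend_measure\<close> is meaningful only once some measure with the
  prescribed box masses is known to exist. The region \<open>S q\<close> below the graph of
  \<open>h q\<close> has mass \<open>C u q\<close> over \<open>{0..u}\<close>; the map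
  \<open>V\<close> turns the nested family \<open>S\<close> into a second coordinate, and the
  Lipschitz property passes from rational levels to real ones.\<close>

lemma copula_measure_exists:
  assumes C: "copula C"
  obtains N :: "(real \<times> real) measure" where "sets N = sets borel"
    "\<And>u v. u \<in> {0..1} \<Longrightarrow> v \<in> {0..1} \<Longrightarrow> emeasure N ({0..u} \<times> {0..v}) = ennreal (C u v)"
proof -
  \<comment> \<open>Clamping \<open>x\<close> to the unit interval extends \<open>C\<close> to a
    distribution function on the whole line without mass outside \<open>{0..1}\<close>.\<close>
  define F where "F v x = C (max 0 (min 1 x)) v" for v x
  note Cb = copula_margins[OF C]
  \<comment> \<open>This is the rectangle inequality of \<open>C\<close>; it makes the measures
    \<open>\<mu> v\<close> increase with \<open>v\<close>.\<close>
  have F_mono: "mono (\<lambda>x. F w x - F v x)" if "v \<in> {0..1}" "w \<in> {0..1}" "v \<le> w" for v w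
  proof (rule monoI)
    fix x y :: real assume "x \<le> y"
    then have "0 \<le> C (max 0 (min 1 y)) w - C (max 0 (min 1 y)) v - C (max 0 (min 1 x)) w + C (max 0 (min 1 x)) v"
      using C that unfolding copula_def by (auto simp: max_def min_def)
    then show "F w x - F v x \<le> F w y - F v y" by (simp add: F_def)
  qed
  have F0: "F 0 = (\<lambda>x. 0)" by (rule ext) (auto simp: F_def Cb)
  have F1: "mono (F v)" if "v \<in> {0..1}" for v
    using F_mono[of 0 v] that by (simp add: F0)
  have F_cont: "continuous_on UNIV (F v)" if "v \<in> {0..1}" for v
  proof -
    have "continuous_on UNIV ((\<lambda>p. C (fst p) (snd p)) \<circ> (\<lambda>x. (max 0 (min 1 x), v)))"
      using that by (intro continuous_on_compose continuous_intros
        continuous_on_subset[OF copula_continuous_on[OF C]]) auto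
    then show ?thesis by (simp add: F_def[abs_def] o_def)
  qed
  define \<mu> where "\<mu> v = interval_measure (F v)" for v
  have Icc: "emeasure (\<mu> v) {a..b} = ennreal (F v b - F v a)" if "v \<in> {0..1}" "a \<le> b" for v a b
    unfolding \<mu>_def using F1[OF that(1)] F_cont[OF that(1)] that(2)
    by (intro emeasure_interval_measure_Icc) (auto simp: mono_def)
  have fin: "finite_measure (\<mu> v)" if v: "v \<in> {0..1}" for v
  proof (rule finite_measureI)
    have "emeasure (\<mu> v) (\<Union>n. {- real n..real n}) \<le> (SUP n. emeasure (\<mu> v) {- real n..real n})"
      by (subst SUP_emeasure_incseq) (auto simp: \<mu>_def incseq_def)
    also have "\<dots> \<le> ennreal v"
    proof (rule SUP_least)
      fix n
      have "F v (real n) \<le> v" "0 \<le> F v (- real n)"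
        using copula_increment_fst(1)[OF C, of "max 0 (min 1 (real n))" 1 v] Cb v
          copula_increment_fst(1)[OF C, of 0 "max 0 (min 1 (-real n))" v] by (auto simp: F_def)
      then show "emeasure (\<mu> v) {- real n..real n} \<le> ennreal v"
        using v by (subst Icc) (auto intro!: ennreal_leI)
    qed
    also have "(\<Union>n. {- real n..real n}) = space (\<mu> v)"
    proof -
      have "\<exists>n. - real n \<le> x \<and> x \<le> real n" for x
        using reals_Archimedean2[of "\<bar>x\<bar>"] by (metis abs_le_iff less_imp_le minus_le_iff)
      then show ?thesis by (auto simp: \<mu>_def)
    qed
    finally show "emeasure (\<mu> v) (space (\<mu> v)) \<noteq> \<infinity>" by (auto simp: top_unique)
  qed
  interpret \<mu>1: finite_measure "\<mu> 1" by (rule fin) auto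
  define Q :: "real set" where "Q = \<rat> \<inter> {0..1}"
  have Q: "countable Q" "0 \<in> Q" "1 \<in> Q" "\<And>q. q \<in> Q \<Longrightarrow> q \<in> {0..1}"
    by (auto simp: Q_def countable_rat)
  obtain h where h: "\<And>q. q \<in> Q \<Longrightarrow> h q \<in> borel_measurable (\<mu> 1)"
    "\<And>q. q \<in> Q \<Longrightarrow> density (\<mu> 1) (h q) = \<mu> q"
    "\<And>p q x. p \<in> Q \<Longrightarrow> q \<in> Q \<Longrightarrow> p \<le> q \<Longrightarrow> h p x \<le> h q x"
  proof (rule monotone_densities[of Q \<mu>])
    show "emeasure (\<mu> p) A \<le> emeasure (\<mu> q) A" if "p \<in> Q" "q \<in> Q" "p \<le> q" "A \<in> sets (\<mu> 1)" for p q A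
      using that Q(4) unfolding \<mu>_def
      by (intro emeasure_interval_measure_mono F1 F_cont F_mono) auto
  qed (use Q fin in \<open>auto simp: \<mu>_def\<close>)
  have [measurable_cong]: "sets (\<mu> 1) = sets borel" by (simp add: \<mu>_def)
  have h_meas[measurable]: "h q \<in> borel_measurable borel" if "q \<in> Q" for q
    using h(1)[OF that] by simp
  have sp: "space (\<mu> 1) = UNIV" by (simp add: \<mu>_def)
  let ?B = "\<mu> 1 \<Otimes>\<^sub>M lborel :: (real \<times> real) measure"
  define S where "S q = {p::real \<times> real. 0 \<le> snd p \<and> ennreal (snd p) \<le> h q (fst p)}" for q
  have S_meas[measurable]: "S q \<in> sets ?B" if [measurable]: "q \<in> Q" for q
  proof -
    have "{p\<in>space ?B. 0 \<le> snd p \<and> ennreal (snd p) \<le> h q (fst p)} \<in> sets ?B"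
      by measurable
    then show ?thesis by (simp add: S_def space_pair_measure sp)
  qed
  have S_mono: "S p \<subseteq> S q" if "p \<in> Q" "q \<in> Q" "p \<le> q" for p q
    using h(3)[OF that] by (auto simp: S_def intro: order_trans)
  \<comment> \<open>A density may take the value infinity, so the fibre of \<open>S q\<close> may be
    a whole half-line.\<close>
  have below: "emeasure lborel {w. 0 \<le> w \<and> ennreal w \<le> c} = c" for c
  proof (cases c)
    case (real r)
    then have "{w. 0 \<le> w \<and> ennreal w \<le> c} = {0..r}" by (auto simp: ennreal_le_iff)
    then show ?thesis using real by simp
  next
    case top
    then have "{w::real. 0 \<le> w \<and> ennreal w \<le> c} = {0..}" by auto
    moreover have "emeasure lborel {0::real..} = top"
    proof (rule ccontr)
      assume "emeasure lborel {0::real..} \<noteq> top"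
      then obtain r where r: "0 \<le> r" "emeasure lborel {0::real..} = ennreal r"
        by (cases "emeasure lborel {0::real..}") auto
      have "ennreal (r + 1) = emeasure lborel {0..r + 1}" using r by simp
      also have "\<dots> \<le> emeasure lborel {0::real..}" by (intro emeasure_mono) auto
      finally show False using r by simp
    qed
    ultimately show ?thesis using top by simp
  qed
  have strip_meas: "S q \<inter> {0..u} \<times> UNIV \<in> sets ?B" if "q \<in> Q" for q u
    using that by (intro sets.Int S_meas pair_measureI) (auto simp: \<mu>_def)
  have S_strip: "emeasure ?B (S q \<inter> {0..u} \<times> UNIV) = ennreal (C u q)" if q: "q \<in> Q" and u: "u \<in> {0..1}" for q u
  proof -
    have "emeasure ?B (S q \<inter> {0..u} \<times> UNIV) = (\<integral>\<^sup>+x. emeasure lborel (Pair x -` (S q \<inter> {0..u} \<times> UNIV)) \<partial>\<mu> 1)"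
      using strip_meas[OF q] by (rule lborel.emeasure_pair_measure_alt)
    also have "\<dots> = (\<integral>\<^sup>+x. h q x * indicator {0..u} x \<partial>\<mu> 1)"
    proof (rule nn_integral_cong)
      fix x
      have "Pair x -` (S q \<inter> {0..u} \<times> UNIV) = (if x \<in> {0..u} then {w. 0 \<le> w \<and> ennreal w \<le> h q x} else {})"
        by (auto simp: S_def)
      then show "emeasure lborel (Pair x -` (S q \<inter> {0..u} \<times> UNIV)) = h q x * indicator {0..u} x"
        by (simp add: below)
    qed
    also have "\<dots> = emeasure (density (\<mu> 1) (h q)) {0..u}"
      using h(1)[OF q] by (simp add: emeasure_density)
    also have "\<dots> = emeasure (\<mu> q) {0..u}" by (simp only: h(2)[OF q])
    also have "\<dots> = ennreal (C u q)"
      using u Q(4)[OF q] by (simp add: Icc F_def Cb)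
    finally show ?thesis .
  qed
  \<comment> \<open>\<open>V p\<close> is the level at which \<open>p\<close> enters the increasing
    family \<open>S\<close>. The default 1 is the top of \<open>Q\<close>, so a value below some
    \<open>q\<close> in \<open>Q\<close> can only come from an actual membership; a countable
    infimum also keeps \<open>V\<close> measurable.\<close>
  define V where "V p = (INF q\<in>Q. if p \<in> S q then q else 1)" for p
  have V_bdd: "bdd_below ((\<lambda>q. if p \<in> S q then q else 1) ` Q)" for p
    by (rule bdd_belowI2[of _ 0]) (use Q(4) in auto)
  have V_le: "V p \<le> q" if "p \<in> S q" "q \<in> Q" for p q
    unfolding V_def using that by (intro cINF_lower2[OF V_bdd]) auto
  have V_less: "p \<in> S q" if "V p < q" "q \<in> Q" for p q
  proof -
    from that obtain r where r: "r \<in> Q" "(if p \<in> S r then r else 1) < q"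
      unfolding V_def using Q(2) V_bdd[of p] by (subst (asm) cINF_less_iff) auto
    then have "p \<in> S r" "r \<le> q" using Q(4)[OF that(2)] by (auto split: if_splits)
    then show ?thesis using S_mono[OF r(1) that(2)] by auto
  qed
  have V01: "0 \<le> V p" for p
    unfolding V_def using Q by (intro cINF_greatest) auto
  have [measurable]: "V \<in> borel_measurable ?B"
    unfolding V_def by (intro borel_measurable_cINF_real measurable_If_set measurable_const Q(1) sets.Int S_meas sets.top) simp_all
  \<comment> \<open>Points outside \<open>S 1\<close> lie in no \<open>S q\<close> and have
    \<open>V p = 1\<close>; without the restriction they would put extra mass at height 1.\<close>
  define N where "N = distr (restrict_space ?B (S 1)) borel (\<lambda>p. (fst p, V p))"
  have m: "(\<lambda>p. (fst p, V p)) \<in> measurable (restrict_space ?B (S 1)) borel"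
    by (intro measurable_restrict_space1) (simp add: borel_prod[symmetric])
  have N: "emeasure N ({0..u} \<times> {0..v}) = emeasure ?B ({p\<in>S 1. V p \<le> v} \<inter> {0..u} \<times> UNIV)"
    if "u \<in> {0..1}" "v \<in> {0..1}" for u v
  proof -
    have "emeasure N ({0..u} \<times> {0..v}) = emeasure (restrict_space ?B (S 1))
        ((\<lambda>p. (fst p, V p)) -` ({0..u} \<times> {0..v}) \<inter> space (restrict_space ?B (S 1)))"
      unfolding N_def using m by (intro emeasure_distr) (auto intro!: borel_closed closed_Times)
    also have "(\<lambda>p. (fst p, V p)) -` ({0..u} \<times> {0..v}) \<inter> space (restrict_space ?B (S 1)) =
        {p\<in>S 1. V p \<le> v} \<inter> {0..u} \<times> UNIV"
      using V01 by (auto simp: space_restrict_space space_pair_measure sp)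
    also have "emeasure (restrict_space ?B (S 1)) \<dots> = emeasure ?B \<dots>"
      using S_meas[OF Q(3)] by (intro emeasure_restrict_space) (auto simp: space_pair_measure sp)
    finally show ?thesis .
  qed
  have T_meas: "{p\<in>S 1. V p \<le> v} \<inter> {0..u} \<times> UNIV \<in> sets ?B" for u v
  proof -
    have "{p\<in>space ?B. V p \<le> v} \<in> sets ?B" by measurable
    moreover have "{0..u} \<times> UNIV \<in> sets ?B" by (intro pair_measureI) (auto simp: \<mu>_def)
    ultimately have "S 1 \<inter> {p\<in>space ?B. V p \<le> v} \<inter> {0..u} \<times> UNIV \<in> sets ?B"
      by (intro sets.Int S_meas Q(3))
    also have "S 1 \<inter> {p\<in>space ?B. V p \<le> v} \<inter> {0..u} \<times> UNIV = {p\<in>S 1. V p \<le> v} \<inter> {0..u} \<times> UNIV"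
      by (auto simp: space_pair_measure sp)
    finally show ?thesis .
  qed
  have lip: "C u q \<le> C u v + \<bar>q - v\<bar>" if "u \<in> {0..1}" "v \<in> {0..1}" "q \<in> {0..1}" for u v q
    using copula_lipschitz[OF C, of u u q v] that by auto
  have Cnn: "0 \<le> C u v" if "u \<in> {0..1}" "v \<in> {0..1}" for u v
    using copula_increment_fst(1)[OF C, of 0 u v] Cb that by auto
  have "emeasure N ({0..u} \<times> {0..v}) = ennreal (C u v)" if uv: "u \<in> {0..1}" "v \<in> {0..1}" for u v
  proof (rule antisym)
    let ?T = "{p\<in>S 1. V p \<le> v} \<inter> {0..u} \<times> UNIV"
    show "emeasure N ({0..u} \<times> {0..v}) \<le> ennreal (C u v)"
    \<comment> \<open>At \<open>v = 1\<close> there is no larger level in \<open>Q\<close>, but the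
      set in question is contained in the strip of \<open>S 1\<close>.\<close>
    proof (cases "v = 1")
      case True
      have "emeasure ?B ?T \<le> emeasure ?B (S 1 \<inter> {0..u} \<times> UNIV)"
        using strip_meas[OF Q(3)] by (intro emeasure_mono) auto
      then show ?thesis using S_strip[OF Q(3) uv(1)] N[OF uv] True by simp
    next
      case False
      then have v: "v < 1" using uv by auto
      show ?thesis
      proof (rule ennreal_le_epsilon)
        fix e :: real assume e: "0 < e"
        \<comment> \<open>For rational \<open>q\<close> slightly above \<open>v\<close>, the set
          where \<open>V p \<le> v\<close> lies in \<open>S q\<close>, whose strip has mass
          \<open>C u q\<close>, at most \<open>C u v + e\<close>.\<close>
        obtain q where q: "q \<in> \<rat>" "v < q" "q < min 1 (v + e)"
          using Rats_dense_in_real[of v "min 1 (v + e)"] v e by auto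
        then have qQ: "q \<in> Q" using uv by (auto simp: Q_def)
        have "emeasure ?B ?T \<le> emeasure ?B (S q \<inter> {0..u} \<times> UNIV)"
          using V_less[OF _ qQ] q strip_meas[OF qQ] by (intro emeasure_mono) auto
        also have "\<dots> \<le> ennreal (C u v + e)"
          using S_strip[OF qQ uv(1)] lip[of u v q] uv q qQ Q(4) by (auto intro!: ennreal_leI)
        finally show "emeasure N ({0..u} \<times> {0..v}) \<le> ennreal (C u v) + ennreal e"
          using N[OF uv] Cnn[OF uv] e by simp
      qed
    qed
    show "ennreal (C u v) \<le> emeasure N ({0..u} \<times> {0..v})"
    proof (cases "v = 0")
      case True
      then show ?thesis using uv by (simp add: Cb)
    next
      case False
      then have v: "0 < v" using uv by auto
      show ?thesis
      proof (rule ennreal_le_epsilon)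
        fix e :: real assume e: "0 < e"
        \<comment> \<open>Dually, for rational \<open>q\<close> slightly below \<open>v\<close>, the
          region \<open>S q\<close> lies in the set where \<open>V p \<le> v\<close>.\<close>
        obtain q where q: "q \<in> \<rat>" "max 0 (v - e) < q" "q < v"
          using Rats_dense_in_real[of "max 0 (v - e)" v] v e by auto
        then have qQ: "q \<in> Q" using uv by (auto simp: Q_def)
        have "ennreal (C u v) \<le> ennreal (C u q + e)"
          using lip[of u q v] uv q qQ Q(4) by (auto intro!: ennreal_leI)
        also have "\<dots> = ennreal (C u q) + ennreal e"
          using e Cnn uv Q(4)[OF qQ] by simp
        also have "ennreal (C u q) = emeasure ?B (S q \<inter> {0..u} \<times> UNIV)"
          using S_strip[OF qQ uv(1)] by simp
        also have "\<dots> \<le> emeasure ?B ?T"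
        proof (rule emeasure_mono)
          have "V p \<le> v" "p \<in> S 1" if "p \<in> S q" for p
            using V_le[OF that qQ] S_mono[OF qQ Q(3)] q(3) Q(4)[OF qQ] that by auto
          then show "S q \<inter> {0..u} \<times> UNIV \<subseteq> ?T" by blast
        qed (rule T_meas)
        finally show "ennreal (C u v) \<le> emeasure N ({0..u} \<times> {0..v}) + ennreal e"
          using N[OF uv] by simp
      qed
    qed
  qed
  moreover have "sets N = sets borel" by (simp add: N_def)
  ultimately show ?thesis using that by blast
qed

section \<open>Box masses of the copula measure\<close>

lemma sets_copula_measure:
  "sets (copula_measure C) = sigma_sets ({0..1} \<times> {0..1}) ((\<lambda>(u, v). {0..u} \<times> {0..v}) ` ({0..1} \<times> {0..1}))"
  unfolding copula_measure_def by (rule sets_extend_measure) auto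

lemma space_copula_measure: "space (copula_measure C) = {0..1} \<times> {0..1}"
  unfolding copula_measure_def by (rule space_extend_measure) auto

text \<open>The extension theorem asks for a countably additive set function with the right values
  on the boxes. The measure \<open>N\<close> on the plane supplies it, as the sigma-algebra
  generated by the boxes consists of Borel sets.\<close>

lemma emeasure_copula_measure_box:
  assumes C: "copula C" and "u \<in> {0..1}" "v \<in> {0..1}"
  shows "emeasure (copula_measure C) ({0..u} \<times> {0..v}) = ennreal (C u v)"
proof -
  obtain N :: "(real \<times> real) measure" where N: "sets N = sets borel"
    "\<And>u v. u \<in> {0..1} \<Longrightarrow> v \<in> {0..1} \<Longrightarrow> emeasure N ({0..u} \<times> {0..v}) = ennreal (C u v)"
    using copula_measure_exists[OF C] by blast
  let ?G = "(\<lambda>(u, v). {0..u} \<times> {0..v}) ` ({0..1} \<times> {0..1}) :: (real \<times> real) set set"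
  have "A \<in> sets borel" if "A \<in> sigma_sets ({0..1} \<times> {0..1}) ?G" for A
    using that
  proof induction
    case (Compl a)
    then show ?case by (intro sets.Diff) (auto intro!: borel_closed closed_Times)
  qed (auto intro!: borel_closed closed_Times)
  then have sub: "sets (copula_measure C) \<subseteq> sets N"
    by (auto simp: sets_copula_measure N)
  have "countably_additive (sets (copula_measure C)) (emeasure N)"
    unfolding countably_additive_def using sub by (auto intro!: suminf_emeasure)
  then have "emeasure (copula_measure C) ((\<lambda>(u, v). {0..u} \<times> {0..v}) (u, v)) = (\<lambda>(u, v). ennreal (C u v)) (u, v)"
    using N assms(2,3) by (intro emeasure_extend_measure[where \<mu>'="emeasure N", OF copula_measure_def])
      (auto simp: positive_def)
  then show ?thesis by simp
qed

subsection \<open>The footrule as an integral over the diagonal\<close>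

text \<open>By inclusion-exclusion the part of the square with both coordinates above
  \<open>t\<close> has mass \<open>1 - 2 * t + C t t\<close>; Fubini integrates this over
  \<open>t\<close>, and \<open>1 - 2 * t\<close> contributes 0.\<close>

lemma integral_min_copula_measure:
  assumes C: "copula C"
  shows "(LINT (u, v)|copula_measure C. min u v) = integral {0..1} (\<lambda>t. C t t)"
    and "(\<lambda>t. C t t) integrable_on {0..1}"
proof -
  let ?M = "copula_measure C"
  note Cb = copula_margins[OF C]
  have box: "{0..u} \<times> {0..v} \<in> sets ?M" if "u \<in> {0..1}" "v \<in> {0..1}" for u v
    using that by (auto simp: sets_copula_measure intro!: sigma_sets.Basic)
  have em1: "emeasure ?M (space ?M) = 1"
    using emeasure_copula_measure_box[OF C, of 1 1] Cb by (simp add: space_copula_measure)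
  interpret finite_measure ?M by (rule finite_measureI) (simp add: em1)
  interpret pair_sigma_finite ?M lborel ..
  \<comment> \<open>The sigma-algebra is known only through its generating boxes, so measurability
    of the projections is read off from half-planes, which meet the square in nothing, a box or
    everything.\<close>
  have half: "{p \<in> space ?M. fst p \<le> a} \<in> sets ?M" "{p \<in> space ?M. snd p \<le> a} \<in> sets ?M" for a
  proof -
    consider "a < 0" | "0 \<le> a" "a \<le> 1" | "1 < a" by linarith
    then have "{p \<in> space ?M. fst p \<le> a} \<in> sets ?M \<and> {p \<in> space ?M. snd p \<le> a} \<in> sets ?M"
    proof cases
      case 1
      then have "{p \<in> space ?M. fst p \<le> a} = {}" "{p \<in> space ?M. snd p \<le> a} = {}"
        by (auto simp: space_copula_measure)
      then show ?thesis by (simp only: sets.empty_sets)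
    next
      case 2
      then have "{p \<in> space ?M. fst p \<le> a} = {0..a} \<times> {0..1}" "{p \<in> space ?M. snd p \<le> a} = {0..1} \<times> {0..a}"
        by (auto simp: space_copula_measure)
      then show ?thesis using box 2 by simp
    next
      case 3
      then have "{p \<in> space ?M. fst p \<le> a} = space ?M" "{p \<in> space ?M. snd p \<le> a} = space ?M"
        by (auto simp: space_copula_measure)
      then show ?thesis by (simp only: sets.top)
    qed
    then show "{p \<in> space ?M. fst p \<le> a} \<in> sets ?M" "{p \<in> space ?M. snd p \<le> a} \<in> sets ?M" by auto
  qed
  have [measurable]: "fst \<in> borel_measurable ?M" "snd \<in> borel_measurable ?M"
    using half by (auto simp: borel_measurable_iff_le)
  \<comment> \<open>The rectangle inequality on the squares over \<open>[t, 1]\<close> and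
    \<open>[0, t]\<close>; nonnegativity allows the change between the two kinds of
    integral.\<close>
  have diag01: "0 \<le> 1 - 2 * t + C t t" "0 \<le> C t t" if "t \<in> {0..1}" for t
  proof -
    have "0 \<le> C 1 1 - C 1 t - C t 1 + C t t" "0 \<le> C t t - C t 0 - C 0 t + C 0 0"
      using C[unfolded copula_def, THEN conjunct2, rule_format, of t 1 t 1]
        C[unfolded copula_def, THEN conjunct2, rule_format, of 0 t 0 t] that by auto
    then show "0 \<le> 1 - 2 * t + C t t" "0 \<le> C t t" using Cb that by auto
  qed
  have cont: "continuous_on {0..1} (\<lambda>t. C t t)"
  proof -
    have "continuous_on {0..1} ((\<lambda>p. C (fst p) (snd p)) \<circ> (\<lambda>x. (x, x)))"
      by (intro continuous_on_compose continuous_intros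
        continuous_on_subset[OF copula_continuous_on[OF C]]) auto
    then show ?thesis by (simp add: o_def)
  qed
  show int: "(\<lambda>t. C t t) integrable_on {0..1}"
    using cont by (rule integrable_continuous_real)
  have upper: "emeasure ?M {p\<in>space ?M. t < fst p \<and> t < snd p} = ennreal (1 - 2 * t + C t t)"
    if t: "t \<in> {0..1}" for t
  proof -
    let ?A = "{0..t} \<times> {0..1}" and ?B = "{0..1} \<times> {0..t}"
    have mb: "measure ?M ({0..u} \<times> {0..v}) = C u v" if "u \<in> {0..1}" "v \<in> {0..1}" for u v
    proof -
      have "0 \<le> C u v" using copula_increment_fst(1)[OF C, of 0 u v] Cb that by auto
      then show ?thesis using emeasure_copula_measure_box[OF C that] by (simp add: measure_def)
    qed
    have "{p\<in>space ?M. t < fst p \<and> t < snd p} = space ?M - (?A \<union> ?B)"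
      by (auto simp: space_copula_measure)
    moreover have "measure ?M (space ?M - (?A \<union> ?B)) = measure ?M (space ?M) - measure ?M (?A \<union> ?B)"
      using box t by (intro finite_measure_compl sets.Un) auto
    moreover have "measure ?M (?A \<union> ?B) = measure ?M ?A + measure ?M ?B - measure ?M (?A \<inter> ?B)"
    proof -
      have "measure ?M (?A \<union> ?B) = measure ?M ?A + measure ?M (?B - ?A)"
        using box t by (intro finite_measure_Union') auto
      moreover have "measure ?M (?B - ?A) = measure ?M ?B - measure ?M (?A \<inter> ?B)"
        using box t by (subst finite_measure_Diff') (auto simp: Int_commute)
      ultimately show ?thesis by simp
    qed
    moreover have "?A \<inter> ?B = {0..t} \<times> {0..t}" using t by auto
    ultimately have "measure ?M {p\<in>space ?M. t < fst p \<and> t < snd p} = 1 - 2 * t + C t t"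
      using mb[of 1 1] mb[of t 1] mb[of 1 t] mb[of t t] t Cb by (simp add: space_copula_measure)
    then show ?thesis by (simp add: emeasure_eq_measure)
  qed
  have "(\<integral>\<^sup>+p. ennreal (min (fst p) (snd p)) \<partial>?M) =
      (\<integral>\<^sup>+p. (\<integral>\<^sup>+t. indicator {t. 0 \<le> t \<and> t < fst p \<and> t < snd p} t \<partial>lborel) \<partial>?M)"
  proof (rule nn_integral_cong)
    fix p assume "p \<in> space ?M"
    then have "0 \<le> min (fst p) (snd p)" by (auto simp: space_copula_measure)
    moreover have "{t. 0 \<le> t \<and> t < fst p \<and> t < snd p} = {0..<min (fst p) (snd p)}" by auto
    ultimately show "ennreal (min (fst p) (snd p)) = (\<integral>\<^sup>+t. indicator {t. 0 \<le> t \<and> t < fst p \<and> t < snd p} t \<partial>lborel)"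
      by simp
  qed
  also have "\<dots> = (\<integral>\<^sup>+t. (\<integral>\<^sup>+p. indicator {t. 0 \<le> t \<and> t < fst p \<and> t < snd p} t \<partial>?M) \<partial>lborel)"
    by (rule Fubini'[symmetric]) (simp add: case_prod_unfold indicator_def, measurable)
  also have "\<dots> = (\<integral>\<^sup>+t. ennreal (indicator {0..1} t *\<^sub>R (1 - 2 * t + C t t)) \<partial>lborel)"
  proof (rule nn_integral_cong)
    fix t :: real
    have m: "{p\<in>space ?M. t < fst p \<and> t < snd p} \<in> sets ?M" by measurable
    have "(\<integral>\<^sup>+p. indicator {t. 0 \<le> t \<and> t < fst p \<and> t < snd p} t \<partial>?M) =
        (\<integral>\<^sup>+p. indicator {p\<in>space ?M. t < fst p \<and> t < snd p} p * indicator {0..1} t \<partial>?M)"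
      by (rule nn_integral_cong) (auto simp: indicator_def space_copula_measure)
    also have "\<dots> = emeasure ?M {p\<in>space ?M. t < fst p \<and> t < snd p} * indicator {0..1} t"
      using m by (subst nn_integral_multc) auto
    also have "\<dots> = ennreal (indicator {0..1} t *\<^sub>R (1 - 2 * t + C t t))"
      using upper by (auto simp: indicator_def)
    finally show "(\<integral>\<^sup>+p. indicator {t. 0 \<le> t \<and> t < fst p \<and> t < snd p} t \<partial>?M) =
      ennreal (indicator {0..1} t *\<^sub>R (1 - 2 * t + C t t))" .
  qed
  also have "\<dots> = ennreal (LINT t:{0..1}|lborel. 1 - 2 * t + C t t)"
    unfolding set_lebesgue_integral_def using diag01(1) cont
    by (intro nn_integral_eq_integral borel_integrable_atLeastAtMost'[unfolded set_integrable_def] continuous_intros)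
      (auto simp: indicator_def)
  also have "(LINT t:{0..1}|lborel. 1 - 2 * t + C t t) = integral {0..1} (\<lambda>t. 1 - 2 * t + C t t)"
    using cont by (intro set_borel_integral_eq_integral borel_integrable_atLeastAtMost' continuous_intros)
  also have "\<dots> = integral {0..1} (\<lambda>t. C t t)"
  proof -
    have "((\<lambda>t::real. 1 - 2 * t) has_integral ((1 - 1\<^sup>2) - (0 - 0\<^sup>2))) {0..1}"
      by (rule fundamental_theorem_of_calculus)
        (auto intro!: derivative_eq_intros simp flip: has_real_derivative_iff_has_vector_derivative)
    from has_integral_add[OF this integrable_integral[OF int]] show ?thesis by (simp add: integral_unique)
  qed
  finally have nn: "(\<integral>\<^sup>+p. ennreal (min (fst p) (snd p)) \<partial>?M) = ennreal (integral {0..1} (\<lambda>t. C t t))" .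
  have "(LINT p|?M. min (fst p) (snd p)) = enn2real (\<integral>\<^sup>+p. ennreal (min (fst p) (snd p)) \<partial>?M)"
    by (intro integral_eq_nn_integral AE_I2) (auto simp: space_copula_measure)
  also have "\<dots> = integral {0..1} (\<lambda>t. C t t)"
    using nn integral_nonneg[OF int] diag01(2) by simp
  finally show "(LINT (u, v)|?M. min u v) = integral {0..1} (\<lambda>t. C t t)"
    by (simp add: case_prod_unfold)
qed

lemma footrule_eq:
  assumes "copula C"
  shows "footrule C = 6 * integral {0..1} (\<lambda>t. C t t) - 2"
  using integral_min_copula_measure(1)[OF assms]
  by (simp add: footrule_def concordance_def copula_M_def)

subsection \<open>Shuffles of \<open>M\<close>\<close>

text \<open>The minimum of two increasing functions of one variable each is the distribution
  function of a mass on an increasing curve, up to constants.\<close>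

lemma supermodular_min:
  fixes f g :: "real \<Rightarrow> real"
  assumes "mono f" "mono g" "a \<le> b" "c \<le> d"
  shows "0 \<le> min (f b) (g d) - min (f b) (g c) - min (f a) (g d) + min (f a) (g c)"
  using monoD[OF assms(1,3)] monoD[OF assms(2,4)] by linarith

definition shuffle_copula :: "real \<Rightarrow> real \<Rightarrow> real \<Rightarrow> real \<Rightarrow> real" where
  "shuffle_copula p q u v = min (min u v) (max 0 (u - p) + max 0 (v - q))"

text \<open>
  The copula is a shuffle of \<open>M\<close>: its mass sits on \<open>v = u + q\<close> over \<open>[0, p]\<close>, on \<open>v = u - p\<close> over
  \<open>[p, p + q]\<close> and on \<open>v = u\<close> beyond. The three summands are the contributions of these segments.
\<close>

lemma shuffle_copula_eq_sum:
  assumes "0 \<le> p" "0 \<le> q" "0 \<le> u" "0 \<le> v"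
  shows "shuffle_copula p q u v = min (min u p) (max 0 (min p (v - q))) + min (max 0 (min q (u - p))) (min v q)
    + min (max 0 (u - p - q)) (max 0 (v - p - q))"
proof -
  consider "u \<le> p" | "p \<le> u" "u \<le> p + q" | "p + q \<le> u" by linarith
  then show ?thesis
  proof cases
    case 1
    consider "v \<le> q" | "q \<le> v" "v \<le> p + q" | "p + q \<le> v" by linarith
    then show ?thesis using 1 assms by cases (simp_all add: shuffle_copula_def min_def max_def)
  next
    case 2
    consider "v \<le> q" | "q \<le> v" "v \<le> p + q" | "p + q \<le> v" by linarith
    then show ?thesis using 2 assms by cases (simp_all add: shuffle_copula_def min_def max_def)
  next
    case 3
    consider "v \<le> q" | "q \<le> v" "v \<le> p + q" | "p + q \<le> v" by linarith
    then show ?thesis using 3 assms by cases (simp_all add: shuffle_copula_def min_def max_def)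
  qed
qed

text \<open>Each of the three summands is a minimum of increasing functions, so
  \<open>supermodular_min\<close> gives the rectangle inequality segment by segment.\<close>

lemma copula_shuffle_copula:
  assumes "0 \<le> p" "0 \<le> q" "p + q \<le> 1"
  shows "copula (shuffle_copula p q)"
  unfolding copula_def
proof (intro conjI ballI allI impI)
  define f g h where "f u v = min (min u p) (max 0 (min p (v - q)))"
    and "g u v = min (max 0 (min q (u - p))) (min v q)"
    and "h u v = min (max 0 (u - p - q)) (max 0 (v - p - q))" for u v
  fix u1 u2 v1 v2 :: real
  assume *: "0 \<le> u1 \<and> u1 \<le> u2 \<and> u2 \<le> 1 \<and> 0 \<le> v1 \<and> v1 \<le> v2 \<and> v2 \<le> 1"
  have "0 \<le> f u2 v2 - f u2 v1 - f u1 v2 + f u1 v1"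
    unfolding f_def using *
    by (intro supermodular_min[of "\<lambda>u. min u p" "\<lambda>v. max 0 (min p (v - q))"]) (auto intro!: monoI)
  moreover have "0 \<le> g u2 v2 - g u2 v1 - g u1 v2 + g u1 v1"
    unfolding g_def using *
    by (intro supermodular_min[of "\<lambda>u. max 0 (min q (u - p))" "\<lambda>v. min v q"]) (auto intro!: monoI)
  moreover have "0 \<le> h u2 v2 - h u2 v1 - h u1 v2 + h u1 v1"
    unfolding h_def using *
    by (intro supermodular_min[of "\<lambda>u. max 0 (u - p - q)" "\<lambda>v. max 0 (v - p - q)"]) (auto intro!: monoI)
  moreover have "shuffle_copula p q u v = f u v + g u v + h u v" if "0 \<le> u" "0 \<le> v" for u v
    unfolding f_def g_def h_def using assms that by (intro shuffle_copula_eq_sum)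
  ultimately show "0 \<le> shuffle_copula p q u2 v2 - shuffle_copula p q u2 v1 - shuffle_copula p q u1 v2 + shuffle_copula p q u1 v1"
    using * by simp
qed (use assms in \<open>auto simp: shuffle_copula_def max_def min_def\<close>)

text \<open>This is the law of \<open>(U, 1 - V)\<close> when \<open>(U, V)\<close> has law
  \<open>C\<close>; the rectangle inequality is that of the reflected rectangle.\<close>

lemma copula_flip:
  assumes "copula C"
  shows "copula (\<lambda>u v. u - C u (1 - v))"
  unfolding copula_def
proof (intro conjI ballI allI impI)
  fix u1 u2 v1 v2 :: real
  assume "0 \<le> u1 \<and> u1 \<le> u2 \<and> u2 \<le> 1 \<and> 0 \<le> v1 \<and> v1 \<le> v2 \<and> v2 \<le> 1"
  then have "0 \<le> C u2 (1 - v1) - C u2 (1 - v2) - C u1 (1 - v1) + C u1 (1 - v2)"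
    using assms unfolding copula_def by auto
  then show "0 \<le> u2 - C u2 (1 - v2) - (u2 - C u2 (1 - v1)) - (u1 - C u1 (1 - v2)) + (u1 - C u1 (1 - v1))"
    by simp
qed (use assms in \<open>auto simp: copula_def\<close>)

lemma copula_convex:
  assumes "copula C" "copula D" "0 \<le> s" "s \<le> 1"
  shows "copula (\<lambda>u v. (1 - s) * C u v + s * D u v)"
  unfolding copula_def
proof (intro conjI ballI allI impI)
  fix u1 u2 v1 v2 :: real
  assume "0 \<le> u1 \<and> u1 \<le> u2 \<and> u2 \<le> 1 \<and> 0 \<le> v1 \<and> v1 \<le> v2 \<and> v2 \<le> 1"
  then have "0 \<le> C u2 v2 - C u2 v1 - C u1 v2 + C u1 v1" "0 \<le> D u2 v2 - D u2 v1 - D u1 v2 + D u1 v1"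
    using assms unfolding copula_def by auto
  then have "0 \<le> (1 - s) * (C u2 v2 - C u2 v1 - C u1 v2 + C u1 v1) + s * (D u2 v2 - D u2 v1 - D u1 v2 + D u1 v1)"
    using assms by simp
  then show "0 \<le> (1 - s) * C u2 v2 + s * D u2 v2 - ((1 - s) * C u2 v1 + s * D u2 v1)
      - ((1 - s) * C u1 v2 + s * D u1 v2) + ((1 - s) * C u1 v1 + s * D u1 v1)"
    by (simp add: algebra_simps)
qed (use assms in \<open>auto simp: copula_def algebra_simps\<close>)

section \<open>Asymmetry of the extremal copulas\<close>

lemma asymmetry_eqI:
  assumes C: "copula C" and m: "a \<in> {0..1}" "b \<in> {0..1}" "\<bar>C a b - C b a\<bar> = m"
    and le: "\<And>u v. u \<in> {0..1} \<Longrightarrow> v \<in> {0..1} \<Longrightarrow> \<bar>C u v - C v u\<bar> \<le> m"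
  shows "asymmetry C = m"
proof -
  obtain u v where uv: "u \<in> {0..1}" "v \<in> {0..1}" "asymmetry C = \<bar>C u v - C v u\<bar>"
    "\<forall>x\<in>{0..1}. \<forall>y\<in>{0..1}. \<bar>C x y - C y x\<bar> \<le> \<bar>C u v - C v u\<bar>"
    using asymmetry_is_max[OF C] by blast
  show ?thesis
    using uv(3) bspec[OF bspec[OF uv(4) m(1)] m(2)] le[OF uv(1,2)] m(3) by linarith
qed

text \<open>The values at \<open>(u, v)\<close> and \<open>(v, u)\<close> thus share an interval of
  length \<open>q\<close>, which bounds the asymmetry by \<open>q\<close>.\<close>

lemma shuffle_copula_bounds:
  assumes "0 \<le> q"
  shows "min u v - q \<le> shuffle_copula p q u v" "shuffle_copula p q u v \<le> min u v"
  using assms unfolding shuffle_copula_def by linarith+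

lemma asymmetry_shuffle_copula:
  assumes "0 \<le> m" "m \<le> 1/3"
  shows "asymmetry (shuffle_copula (2 * m) m) = m"
proof (rule asymmetry_eqI[of _ m "2 * m"])
  \<comment> \<open>At the witness \<open>(m, 2 * m)\<close> the copula equals \<open>m\<close>, at
    the transposed point 0.\<close>
  show "\<bar>shuffle_copula (2 * m) m u v - shuffle_copula (2 * m) m v u\<bar> \<le> m" if "u \<in> {0..1}" "v \<in> {0..1}" for u v
    using shuffle_copula_bounds[where q=m and p="2 * m" and u=u and v=v] shuffle_copula_bounds[where q=m and p="2 * m" and u=v and v=u]
      assms by linarith
qed (use assms in \<open>auto intro: copula_shuffle_copula simp: shuffle_copula_def\<close>)

lemma asymmetry_flip_shuffle_copula:
  assumes "0 \<le> m" "m \<le> 1/3"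
  shows "asymmetry (\<lambda>u v. u - shuffle_copula m m u (1 - v)) = m"
proof (rule asymmetry_eqI[of _ m "1 - m"])
  \<comment> \<open>Here \<open>u - min u (1 - v) = max 0 (u + v - 1)\<close> is symmetric, so only
    the error of at most \<open>m\<close> matters. At the witness \<open>(m, 1 - m)\<close> the
    value is \<open>m\<close>; at the transposed point it is 0, because \<open>m \<le> 1/3\<close>
    gives \<open>1 - m \<le> 2 * (1 - 2 * m)\<close>.\<close>
  show "\<bar>(u - shuffle_copula m m u (1 - v)) - (v - shuffle_copula m m v (1 - u))\<bar> \<le> m" if "u \<in> {0..1}" "v \<in> {0..1}" for u v
    using shuffle_copula_bounds[where q=m and p=m and u=u and v="1 - v"] shuffle_copula_bounds[where q=m and p=m and u=v and v="1 - u"]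
      assms by linarith
qed (use assms copula_flip[OF copula_shuffle_copula[of m m]] in \<open>auto simp: shuffle_copula_def\<close>)

subsection \<open>Bounds on the diagonal\<close>

text \<open>Swapping the names of the coordinates arranges \<open>a \<le> b\<close>; transposing the
  copula, which keeps its diagonal, arranges the sign.\<close>

lemma asymmetry_witness:
  assumes C: "copula C"
  obtains D a b where "copula D" "\<And>t. D t t = C t t" "0 \<le> a" "a \<le> b" "b \<le> 1" "D a b - D b a = asymmetry C"
proof -
  obtain u v where uv: "u \<in> {0..1}" "v \<in> {0..1}" "asymmetry C = \<bar>C u v - C v u\<bar>"
    using asymmetry_is_max[OF C] by blast
  have "\<exists>a b. a \<in> {0..1} \<and> b \<in> {0..1} \<and> a \<le> b \<and> \<bar>C a b - C b a\<bar> = asymmetry C"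
  proof (cases "u \<le> v")
    case True
    then show ?thesis using uv by metis
  next
    case False
    then have "v \<le> u" by simp
    then show ?thesis using uv abs_minus_commute[of "C u v" "C v u"] by metis
  qed
  then obtain a b where ab: "a \<in> {0..1}" "b \<in> {0..1}" "a \<le> b" "\<bar>C a b - C b a\<bar> = asymmetry C" by blast
  show ?thesis
  proof (cases "C b a \<le> C a b")
    case True
    then show ?thesis using that[of C a b] C ab by auto
  next
    case False
    then show ?thesis using that[of "\<lambda>u v. C v u" a b] copula_transpose[OF C] ab by auto
  qed
qed

lemma copula_diag_bounds:
  assumes "copula C" "t \<in> {0..1}"
  shows "C t t \<le> t" "0 \<le> C t t" "2 * t - 1 \<le> C t t"
  using copula_increment_fst[OF assms(1), of t 1 t] copula_increment_fst[OF assms(1), of 0 t t] assms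
  by (auto simp: copula_def)

text \<open>The gaps from 0 to \<open>a\<close>, from \<open>a\<close> to \<open>b\<close> and from
  \<open>b\<close> to 1 all have length at least \<open>m\<close>, by \<open>D a b \<le> a\<close>,
  by \<open>D a b - (b - a) \<le> D a a \<le> D b a\<close> and by
  \<open>a + b - 1 \<le> D b a\<close>. In particular \<open>3 * m \<le> 1\<close>.\<close>

lemma asymmetric_pair:
  assumes D: "copula D" and ab: "0 \<le> a" "a \<le> b" "b \<le> 1" and m: "D a b - D b a = m" "0 \<le> m"
  shows "m \<le> a" "b \<le> 1 - m" "a + m \<le> b" "D b a \<le> a - m" "m \<le> D a b"
proof -
  note Db = copula_margins[OF D]
  note inc = copula_increment_fst[OF D] copula_increment_fst[OF copula_transpose[OF D]]
  have "D a b \<le> a" using inc(3)[of b 1 a] Db ab by auto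
  moreover have "0 \<le> D b a" using inc(1)[of 0 b a] Db ab by auto
  moreover have "a + b - 1 \<le> D b a" using inc(2)[of b 1 a] Db ab by auto
  moreover have "D a a \<le> D b a" "D a b - D a a \<le> b - a" using inc(1)[of a b a] inc(4)[of a b a] ab by auto
  ultimately show "m \<le> a" "b \<le> 1 - m" "a + m \<le> b" "D b a \<le> a - m" "m \<le> D a b" using m by linarith+
qed

text \<open>Go from \<open>(b, a)\<close> to \<open>(b, t)\<close> and on to \<open>(t, t)\<close>:
  growth has rate at most 1, and a decreasing coordinate adds nothing.\<close>

lemma diag_le:
  assumes D: "copula D" and ab: "0 \<le> a" "a \<le> b" "b \<le> 1" and m: "D a b - D b a = m" "0 \<le> m" and t: "t \<in> {0..1}"
  shows "D t t \<le> (a - m) + max 0 (t - a) + max 0 (t - b)"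
proof -
  note inc = copula_increment_fst[OF D] copula_increment_fst[OF copula_transpose[OF D]]
  have "D t t - D b t \<le> max 0 (t - b)"
    using inc(1)[of t b t] inc(2)[of b t t] t ab by (cases "t \<le> b") auto
  moreover have "D b t - D b a \<le> max 0 (t - a)"
    using inc(3)[of t a b] inc(4)[of a t b] t ab by (cases "t \<le> a") auto
  ultimately show ?thesis using asymmetric_pair(4)[OF D ab m] by linarith
qed

text \<open>Go from \<open>(a, b)\<close>, where \<open>D\<close> is at least \<open>m\<close>, to
  \<open>(a, t)\<close>, losing at most \<open>max 0 (b - t)\<close>, and on to
  \<open>(t, t)\<close>, losing nothing since \<open>a \<le> 1 - 2 * m \<le> t\<close>. The bound
  follows from \<open>b \<le> 1 - m\<close> and \<open>t \<le> 1 - m\<close>.\<close>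

lemma diag_ge:
  assumes D: "copula D" and ab: "0 \<le> a" "a \<le> b" "b \<le> 1" and m: "D a b - D b a = m" "0 \<le> m"
    and t: "1 - 2 * m \<le> t" "t \<le> 2 * m"
  shows "t + 2 * m - 1 \<le> D t t"
proof -
  note p = asymmetric_pair[OF D ab m]
  note inc = copula_increment_fst[OF D] copula_increment_fst[OF copula_transpose[OF D]]
  have t01: "a \<le> t" "0 \<le> t" "t \<le> 1 - m" "t \<le> 1" using p t ab m by linarith+
  have "D a b - D a t \<le> max 0 (b - t)"
    using inc(3)[of b t a] inc(4)[of t b a] t01 ab by (cases "b \<le> t") auto
  moreover have "D a t \<le> D t t" using inc(1)[of a t t] t01 ab by auto
  ultimately show ?thesis using p t01 by linarith
qed

section \<open>Integrals of the extremal diagonals\<close>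

lemma has_integral_affine_on:
  fixes f :: "real \<Rightarrow> real"
  assumes "x \<le> y" "\<And>t. x \<le> t \<Longrightarrow> t \<le> y \<Longrightarrow> f t = c + d * t"
  shows "(f has_integral (c * (y - x) + d * (y\<^sup>2 - x\<^sup>2) / 2)) {x..y}"
proof -
  have "((\<lambda>t. c + d * t) has_integral ((c * y + d * y\<^sup>2 / 2) - (c * x + d * x\<^sup>2 / 2))) {x..y}"
    using assms(1) by (intro fundamental_theorem_of_calculus)
      (auto intro!: derivative_eq_intros simp flip: has_real_derivative_iff_has_vector_derivative)
  also have "(c * y + d * y\<^sup>2 / 2) - (c * x + d * x\<^sup>2 / 2) = c * (y - x) + d * (y\<^sup>2 - x\<^sup>2) / 2"
    by (simp add: field_simps)
  finally show ?thesis
    using has_integral_cong[of "{x..y}" f "\<lambda>t. c + d * t"] assms(2) by simp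
qed

text \<open>The bound of \<open>diag_le\<close> cut off by \<open>t\<close> is affine between
  \<open>a - m\<close>, \<open>a\<close>, \<open>b\<close> and \<open>b + m\<close>, with slopes 1,
  0, 1, 2, 1. The integral depends on the pair only through \<open>b - a\<close>.\<close>

lemma has_integral_upper_diag:
  assumes "0 \<le> m" "m \<le> a" "a + m \<le> b" "b \<le> 1 - (m::real)"
  shows "((\<lambda>t. min t (a - m + max 0 (t - a) + max 0 (t - b))) has_integral (1/2 - m\<^sup>2 - m * (b - a))) {0..1}"
proof -
  let ?f = "\<lambda>t. min t (a - m + max 0 (t - a) + max 0 (t - b))"
  have "(?f has_integral (0 * (a - m - 0) + 1 * ((a - m)\<^sup>2 - 0\<^sup>2) / 2)) {0..a - m}"
    using assms by (intro has_integral_affine_on) auto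
  moreover have "(?f has_integral ((a - m) * (a - (a - m)) + 0 * (a\<^sup>2 - (a - m)\<^sup>2) / 2)) {a - m..a}"
    using assms by (intro has_integral_affine_on) auto
  moreover have "(?f has_integral ((- m) * (b - a) + 1 * (b\<^sup>2 - a\<^sup>2) / 2)) {a..b}"
    using assms by (intro has_integral_affine_on) auto
  moreover have "(?f has_integral ((- b - m) * (b + m - b) + 2 * ((b + m)\<^sup>2 - b\<^sup>2) / 2)) {b..b + m}"
    using assms by (intro has_integral_affine_on) auto
  moreover have "(?f has_integral (0 * (1 - (b + m)) + 1 * (1\<^sup>2 - (b + m)\<^sup>2) / 2)) {b + m..1}"
    using assms by (intro has_integral_affine_on) auto
  ultimately have "(?f has_integral ((0 * (a - m - 0) + 1 * ((a - m)\<^sup>2 - 0\<^sup>2) / 2) +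
      ((a - m) * (a - (a - m)) + 0 * (a\<^sup>2 - (a - m)\<^sup>2) / 2) + ((- m) * (b - a) + 1 * (b\<^sup>2 - a\<^sup>2) / 2) +
      ((- b - m) * (b + m - b) + 2 * ((b + m)\<^sup>2 - b\<^sup>2) / 2) +
      (0 * (1 - (b + m)) + 1 * (1\<^sup>2 - (b + m)\<^sup>2) / 2))) {0..1}"
    using assms by (intro has_integral_combine[of 0 "b + m" 1] has_integral_combine[of 0 b "b + m"]
      has_integral_combine[of 0 a b] has_integral_combine[of 0 "a - m" a]) auto
  then show ?thesis
    by (rule has_integral_eq_rhs) (simp add: power2_eq_square field_simps)
qed

text \<open>The inner maximum is the diagonal of the smallest copula. The term
  \<open>t + 2 * m - 1\<close> exceeds it only for \<open>t\<close> strictly between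
  \<open>1 - 2 * m\<close> and \<open>2 * m\<close>, a range that is empty for
  \<open>m \<le> 1/4\<close>; hence the two cases of the lower bound.\<close>

definition lower_diag :: "real \<Rightarrow> real \<Rightarrow> real" where
  "lower_diag m t = max (max 0 (2 * t - 1)) (t + 2 * m - 1)"

lemma has_integral_lower_diag:
  assumes "0 \<le> m" "m \<le> 1/3"
  shows "(lower_diag m has_integral (if m \<le> 1/4 then 1/4 else 4 * m\<^sup>2 - 2 * m + 1/2)) {0..1}"
proof (cases "m \<le> 1/4")
  case True
  have "(lower_diag m has_integral (0 * (1/2 - 0) + 0 * ((1/2)\<^sup>2 - 0\<^sup>2) / 2)) {0..1/2}"
    using True assms by (intro has_integral_affine_on) (auto simp: lower_diag_def)
  moreover have "(lower_diag m has_integral ((-1) * (1 - 1/2) + 2 * (1\<^sup>2 - (1/2)\<^sup>2) / 2)) {1/2..1}"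
    using True assms by (intro has_integral_affine_on) (auto simp: lower_diag_def)
  ultimately have "(lower_diag m has_integral ((0 * (1/2 - 0) + 0 * ((1/2)\<^sup>2 - 0\<^sup>2) / 2) +
      ((-1) * (1 - 1/2) + 2 * (1\<^sup>2 - (1/2)\<^sup>2) / 2))) {0..1}"
    by (intro has_integral_combine[of 0 "1/2" 1]) auto
  then show ?thesis
    using True by (elim has_integral_eq_rhs) (simp add: power2_eq_square)
next
  case False
  have "(lower_diag m has_integral (0 * (1 - 2 * m - 0) + 0 * ((1 - 2 * m)\<^sup>2 - 0\<^sup>2) / 2)) {0..1 - 2 * m}"
    using False assms by (intro has_integral_affine_on) (auto simp: lower_diag_def)
  moreover have "(lower_diag m has_integral ((2 * m - 1) * (2 * m - (1 - 2 * m)) + 1 * ((2 * m)\<^sup>2 - (1 - 2 * m)\<^sup>2) / 2)) {1 - 2 * m..2 * m}"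
    using False assms by (intro has_integral_affine_on) (auto simp: lower_diag_def)
  moreover have "(lower_diag m has_integral ((-1) * (1 - 2 * m) + 2 * (1\<^sup>2 - (2 * m)\<^sup>2) / 2)) {2 * m..1}"
    using False assms by (intro has_integral_affine_on) (auto simp: lower_diag_def)
  ultimately have "(lower_diag m has_integral ((0 * (1 - 2 * m - 0) + 0 * ((1 - 2 * m)\<^sup>2 - 0\<^sup>2) / 2) +
      ((2 * m - 1) * (2 * m - (1 - 2 * m)) + 1 * ((2 * m)\<^sup>2 - (1 - 2 * m)\<^sup>2) / 2) +
      ((-1) * (1 - 2 * m) + 2 * (1\<^sup>2 - (2 * m)\<^sup>2) / 2))) {0..1}"
    using False assms by (intro has_integral_combine[of 0 "2 * m" 1] has_integral_combine[of 0 "1 - 2 * m" "2 * m"]) auto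
  then show ?thesis
    using False by (elim has_integral_eq_rhs) (simp add: power2_eq_square field_simps)
qed

section \<open>The footrule bounds and their attainment\<close>

lemma footrule_eqI:
  assumes C: "copula C" and "((\<lambda>t. C t t) has_integral I) {0..1}"
  shows "footrule C = 6 * I - 2"
  using footrule_eq[OF C] assms(2) by (simp add: integral_unique)

lemma footrule_bounds:
  assumes C: "copula C"
  shows "0 \<le> asymmetry C" "asymmetry C \<le> 1/3" "footrule C \<le> 1 - 12 * (asymmetry C)\<^sup>2"
    "footrule C \<ge> (if asymmetry C \<le> 1/4 then - 1/2 else 24 * (asymmetry C)\<^sup>2 - 12 * asymmetry C + 1)"
proof -
  define m where "m = asymmetry C"
  obtain D a b where D: "copula D" "\<And>t. D t t = C t t" and ab: "0 \<le> a" "a \<le> b" "b \<le> 1"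
    and m: "D a b - D b a = m"
    using asymmetry_witness[OF C] m_def by metis
  show m0: "0 \<le> asymmetry C" using asymmetry_is_max[OF C] by fastforce
  then have m0': "0 \<le> m" by (simp add: m_def)
  note p = asymmetric_pair[OF D(1) ab m m0']
  have m3: "m \<le> 1/3" using p m0' by linarith
  then show "asymmetry C \<le> 1/3" by (simp add: m_def)
  have int: "((\<lambda>t. C t t) has_integral integral {0..1} (\<lambda>t. C t t)) {0..1}"
    using integral_min_copula_measure(2)[OF C] by (rule integrable_integral)
  have "integral {0..1} (\<lambda>t. C t t) \<le> 1/2 - m\<^sup>2 - m * (b - a)"
  proof (rule has_integral_le[OF int has_integral_upper_diag])
    show "C t t \<le> min t (a - m + max 0 (t - a) + max 0 (t - b))" if "t \<in> {0..1}" for t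
      using copula_diag_bounds(1)[OF C that] diag_le[OF D(1) ab m m0' that] by (simp add: D)
  qed (use p m0' in auto)
  \<comment> \<open>The upper bound is largest for the closest possible pair,
    \<open>b - a = m\<close>.\<close>
  moreover have "m * m \<le> m * (b - a)" using p m0' by (intro mult_left_mono) auto
  ultimately show "footrule C \<le> 1 - 12 * (asymmetry C)\<^sup>2"
    unfolding m_def[symmetric] footrule_eq[OF C] by (simp add: power2_eq_square)
  have "(if m \<le> 1/4 then 1/4 else 4 * m\<^sup>2 - 2 * m + 1/2) \<le> integral {0..1} (\<lambda>t. C t t)"
  proof (rule has_integral_le[OF has_integral_lower_diag[OF m0' m3] int])
    \<comment> \<open>Outside the range of \<open>diag_ge\<close>, the third term is dominated by 0
      or by \<open>2 * t - 1\<close>.\<close>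
    show "lower_diag m t \<le> C t t" if "t \<in> {0..1}" for t
      using copula_diag_bounds[OF C that] diag_ge[OF D(1) ab m m0', of t] D(2)[of t]
      unfolding lower_diag_def by linarith
  qed
  then show "footrule C \<ge> (if asymmetry C \<le> 1/4 then - 1/2 else 24 * (asymmetry C)\<^sup>2 - 12 * asymmetry C + 1)"
    unfolding m_def[symmetric] footrule_eq[OF C] by (auto split: if_splits)
qed

text \<open>With \<open>a = m\<close> and \<open>b = 2 * m\<close>, the upper diagonal is exactly
  that of the shuffle.\<close>

lemma footrule_upper_attained:
  assumes "0 \<le> m" "m \<le> 1/3"
  shows "footrule (shuffle_copula (2 * m) m) = 1 - 12 * m\<^sup>2"
proof -
  have "((\<lambda>t. shuffle_copula (2 * m) m t t) has_integral (1/2 - m\<^sup>2 - m * (2 * m - m))) {0..1}"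
    using has_integral_upper_diag[of m m "2 * m"] assms
    by (simp add: shuffle_copula_def[abs_def] add.commute)
  from footrule_eqI[OF copula_shuffle_copula this] show ?thesis
    using assms by (simp add: power2_eq_square)
qed

text \<open>For \<open>t\<close> in \<open>[m, 1 - m]\<close> the two positive parts in the shuffle
  add up to the constant \<open>1 - 2 * m\<close>, which produces the term
  \<open>t + 2 * m - 1\<close>.\<close>

lemma diag_flip_shuffle_copula:
  assumes "0 \<le> m" "m \<le> 1/3" "t \<in> {0..1}"
  shows "t - shuffle_copula m m t (1 - t) = lower_diag m t"
  using assms unfolding shuffle_copula_def lower_diag_def by (auto simp: min_def max_def)

lemma footrule_lower_attained:
  assumes "0 \<le> m" "m \<le> 1/3"
  shows "footrule (\<lambda>u v. u - shuffle_copula m m u (1 - v)) =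
    (if m \<le> 1/4 then - 1/2 else 24 * m\<^sup>2 - 12 * m + 1)"
proof -
  have "((\<lambda>t. t - shuffle_copula m m t (1 - t)) has_integral (if m \<le> 1/4 then 1/4 else 4 * m\<^sup>2 - 2 * m + 1/2)) {0..1}"
    using has_integral_lower_diag[OF assms] diag_flip_shuffle_copula[OF assms]
    by (subst has_integral_cong[of _ _ "lower_diag m"]) auto
  from footrule_eqI[OF copula_flip[OF copula_shuffle_copula] this] show ?thesis
    using assms by (auto split: if_splits)
qed

lemma footrule_symmetric_range: "{footrule C | C. symmetric_copula C} = {- 1/2 .. 1}"
proof (intro equalityI subsetI)
  fix x assume "x \<in> {footrule C | C. symmetric_copula C}"
  then obtain C where C: "copula C" "\<forall>u\<in>{0..1}. \<forall>v\<in>{0..1}. C u v = C v u" "x = footrule C"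
    by (auto simp: symmetric_copula_def)
  have "asymmetry C = 0" using asymmetry_is_max[OF C(1)] C(2) by fastforce
  then show "x \<in> {- 1/2 .. 1}" using footrule_bounds[OF C(1)] C(3) by simp
next
  fix x :: real assume x: "x \<in> {- 1/2 .. 1}"
  \<comment> \<open>The copula with parameters 0 is \<open>M\<close>, and its flip \<open>?W\<close>
    is the smallest copula. The footrule of their mixture is \<open>1 - 3 * s / 2\<close>, and
    solving for \<open>x\<close> gives \<open>s\<close>.\<close>
  define s where "s = 2 * (1 - x) / 3"
  let ?W = "\<lambda>u v. u - shuffle_copula 0 0 u (1 - v)"
  let ?C = "\<lambda>u v. (1 - s) * shuffle_copula 0 0 u v + s * ?W u v"
  have "copula ?C"
    using x by (intro copula_convex copula_flip copula_shuffle_copula) (auto simp: s_def)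
  moreover have "?C u v = ?C v u" if "u \<in> {0..1}" "v \<in> {0..1}" for u v
  proof -
    have "shuffle_copula 0 0 u v = shuffle_copula 0 0 v u" "?W u v = ?W v u"
      using that unfolding shuffle_copula_def by linarith+
    then show ?thesis by simp
  qed
  moreover have "((\<lambda>t. ?C t t) has_integral ((1 - s) * (1/2) + s * (1/4))) {0..1}"
  proof (intro has_integral_add has_integral_mult_right)
    show "((\<lambda>t. shuffle_copula 0 0 t t) has_integral 1/2) {0..1}"
      using has_integral_upper_diag[of 0 0 0] by (simp add: shuffle_copula_def[abs_def])
    show "((\<lambda>t. ?W t t) has_integral 1/4) {0..1}"
      using has_integral_lower_diag[of 0] diag_flip_shuffle_copula[of 0]
      by (subst has_integral_cong[of _ _ "lower_diag 0"]) auto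
  qed
  from footrule_eqI[OF \<open>copula ?C\<close> this] have "footrule ?C = x"
    by (simp add: s_def field_simps)
  ultimately show "x \<in> {footrule C | C. symmetric_copula C}"
    unfolding symmetric_copula_def by blast
qed

theorem theorem15:
  "(\<forall>C m. copula C \<and> asymmetry C = m \<longrightarrow>
      footrule C \<le> 1 - 12 * m\<^sup>2 \<and>
      footrule C \<ge> (if m \<le> 1/4 then - 1/2 else 24 * m\<^sup>2 - 12 * m + 1)) \<and>
   (\<forall>m. 0 \<le> m \<and> m \<le> 1/3 \<longrightarrow>
      (\<exists>C. copula C \<and> asymmetry C = m \<and> footrule C = 1 - 12 * m\<^sup>2) \<and>
      (\<exists>C. copula C \<and> asymmetry C = m \<and>
           footrule C = (if m \<le> 1/4 then - 1/2 else 24 * m\<^sup>2 - 12 * m + 1))) \<and>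
   {footrule C | C. symmetric_copula C} = {- 1/2 .. 1} \<and>
   (\<forall>C. copula C \<and> asymmetry C = 1/3 \<longrightarrow> footrule C = - 1/3)"
proof (intro conjI allI impI)
  fix m :: real assume m: "0 \<le> m \<and> m \<le> 1/3"
  show "\<exists>C. copula C \<and> asymmetry C = m \<and> footrule C = 1 - 12 * m\<^sup>2"
    using m asymmetry_shuffle_copula footrule_upper_attained
    by (intro exI[of _ "shuffle_copula (2 * m) m"]) (auto intro!: copula_shuffle_copula)
  show "\<exists>C. copula C \<and> asymmetry C = m \<and>
           footrule C = (if m \<le> 1/4 then - 1/2 else 24 * m\<^sup>2 - 12 * m + 1)"
    using m asymmetry_flip_shuffle_copula footrule_lower_attained
    by (intro exI[of _ "\<lambda>u v. u - shuffle_copula m m u (1 - v)"] conjI copula_flip copula_shuffle_copula) auto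
next
  fix C assume C: "copula C \<and> asymmetry C = 1/3"
  \<comment> \<open>At \<open>m = 1/3\<close> the two bounds coincide.\<close>
  have "footrule C \<le> 1 - 12 * (1/3)\<^sup>2" "footrule C \<ge> 24 * (1/3)\<^sup>2 - 12 * (1/3) + 1"
    using footrule_bounds(3,4)[of C] C by simp_all
  then show "footrule C = - 1/3" by (simp add: power2_eq_square)
qed (use footrule_bounds(3,4) footrule_symmetric_range in blast)+

end
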